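(* If $\lambda_g>\frac{2}{\pi}$, then for $\mathbb{P}$-almost every $\omega\in W^{\mathbb{N}}$ the Fourier transform satisfies $\widehat{\mu}_\omega\in L^1(\mathbb{R})$.
   Context: Let $W=[\lambda_{\min},\lambda_{\max}]\subset(0,1)$ be a closed interval with $\lambda_{\min}<\lambda_{\max}$. Let $\mathbb{P}$ be the product probability measure on $W^{\mathbb{N}}$ ($\mathbb{N}=\{1,2,\dots\}$) each of whose factors is the normalised Lebesgue (uniform) measure on $W$; thus the entries of $\omega=(\lambda_k)_{k\ge1}\in W^{\mathbb{N}}$ are i.i.d. uniform on $W$. Put $\lambda_g=\exp\mathbb{E}(\log\lambda_1)$. For $\omega=(\lambda_k)\in W^{\mathbb{N}}$, the random Bernoulli convolution $\mu_\omega$ is the infinite convolution of the measures $\frac12(\delta_0+\delta_{\lambda_1\lambda_2\cdots\lambda_k})$, $k\ge1$; equivalently, $\mu_\omega$ is the push-forward of the $(\frac12,\frac12)$-Bernoulli measure on $\{0,1\}^{\mathbb{N}}$ under the map $(a_j)\mapsto\sum_{j=1}^\infty a_j\prod_{k=1}^j\lambda_k$. The Fourier transform of a Borel probability measure $\mu$ on $\mathbb{R}$ is $\widehat\mu(\xi)=\int e^{-2\pi i\xi x}\,d\mu(x)$. *)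

theory Defs
  imports "HOL-Probability.Probability"
begin

text \<open>
  Sequences are indexed from 0, so \<open>\<omega> k\<close> stands for the entry \<open>\<lambda>\<^sub>k\<^sub>+\<^sub>1\<close> of
  \<open>\<omega> = (\<lambda>\<^sub>1, \<lambda>\<^sub>2, \<dots>)\<close>, and likewise for the coin tosses.
\<close>

definition uniform_interval :: "real \<Rightarrow> real \<Rightarrow> real measure" where
  "uniform_interval a b = uniform_measure (restrict_space lborel {a..b}) {a..b}"

definition ratio_measure :: "real \<Rightarrow> real \<Rightarrow> (nat \<Rightarrow> real) measure" where
  "ratio_measure a b = (\<Pi>\<^sub>M k\<in>UNIV. uniform_interval a b)"

definition geometric_mean_ratio :: "real \<Rightarrow> real \<Rightarrow> real" where
  "geometric_mean_ratio a b = exp (\<integral>\<omega>. ln (\<omega> 0) \<partial>ratio_measure a b)"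

definition coin_measure :: "(nat \<Rightarrow> bool) measure" where
  "coin_measure = (\<Pi>\<^sub>M j\<in>UNIV. measure_pmf (bernoulli_pmf (1/2)))"

definition random_bernoulli_convolution :: "(nat \<Rightarrow> real) \<Rightarrow> real measure" where
  "random_bernoulli_convolution \<omega> =
     distr coin_measure borel (\<lambda>a. \<Sum>j. of_bool (a j) * (\<Prod>k\<le>j. \<omega> k))"

text \<open>The library's \<open>char\<close> uses the kernel \<open>exp (\<i> t x)\<close>, i.e. a different normalisation.\<close>

definition fourier_transform :: "real measure \<Rightarrow> real \<Rightarrow> complex" where
  "fourier_transform \<mu> \<xi> = (\<integral>x. exp (- 2 * of_real pi * \<i> * of_real \<xi> * of_real x) \<partial>\<mu>)"

end

theory Submission
  imports Defs
begin

text \<open>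
  Write \<open>p\<^sub>n\<close> for the product of the first \<open>n\<close> ratios.  As an infinite convolution of two-point
  measures, \<open>\<mu>\<^sub>\<omega>\<close> has a Fourier transform of modulus \<open>\<Prod>k\<ge>1. \<bar>cos (\<pi> \<xi> p\<^sub>k)\<bar>\<close>, which is
  at most the product of the first \<open>n\<close> factors (\<open>norm_fourier_transform_le_cos_prod\<close>).

  Given the earlier ratios, the \<open>k\<close>-th ratio is uniform on an interval.  So as long as
  \<open>\<bar>\<xi>\<bar> p\<^sub>k\<^sub>-\<^sub>1 \<ge> T\<close> for a large constant \<open>T\<close>, the conditional mean of \<open>\<bar>cos (\<pi> \<xi> p\<^sub>k)\<bar>\<close> is close to
  the mean \<open>2 / \<pi>\<close> of \<open>\<bar>cos\<bar>\<close> over a period, and at most some \<open>q\<close> slightly above \<open>2 / \<pi>\<close>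
  (\<open>nn_integral_abs_cos_uniform_interval_le\<close>).  Hence
  the expectation of the first \<open>n\<close> factors, restricted to the event \<open>\<bar>\<xi>\<bar> p\<^sub>n \<ge> T\<close>, is at most
  \<open>q ^ n\<close>, uniformly in \<open>\<xi>\<close> (\<open>nn_integral_cos_prod_le\<close>).

  Now choose \<open>2 / \<pi> < q < c < \<lambda>\<^sub>g\<close> with \<open>c < 1\<close>.  By the law of large numbers, almost surely \<open>p\<^sub>n \<ge> c ^ n\<close>
  for all large \<open>n\<close> (\<open>AE_eventually_ratio_prod_ge\<close>).  On the shell \<open>T / c ^ n \<le> \<bar>\<xi>\<bar> \<le> T / c ^ Suc n\<close>
  the restricting event is then satisfied.  The shell has length \<open>O(c ^ (-n))\<close>, so that its expected
  contribution to the integral is \<open>O((q / c) ^ n)\<close>, which is summable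
  (\<open>AE_nn_integral_cos_majorant_finite\<close>, \<open>integrable_fourier_transform\<close>).
\<close>

section \<open>The mean of the absolute cosine\<close>

lemma nn_integral_abs_cos_half_period:
  fixes j :: int
  shows "(\<integral>\<^sup>+t. ennreal \<bar>cos t\<bar> * indicator {j * pi - pi / 2..j * pi + pi / 2} t \<partial>lborel) = 2"
proof -
  have eq: "\<bar>cos t\<bar> = cos (t - j * pi)" if "t \<in> {j * pi - pi / 2..j * pi + pi / 2}" for t
  proof -
    have "cos (t - j * pi) \<ge> 0"
      using that by (intro cos_ge_zero) auto
    moreover have "\<bar>cos (t - j * pi)\<bar> = \<bar>cos t\<bar>"
      by (simp add: cos_diff abs_mult mult.commute[of _ pi])
    ultimately show ?thesis by simp
  qed
  have "(\<integral>\<^sup>+t. ennreal \<bar>cos t\<bar> * indicator {j * pi - pi / 2..j * pi + pi / 2} t \<partial>lborel)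
      = (\<integral>\<^sup>+t. ennreal (cos (t - j * pi)) * indicator {j * pi - pi / 2..j * pi + pi / 2} t \<partial>lborel)"
    by (intro nn_integral_cong) (auto simp: eq split: split_indicator)
  also have "\<dots> = ennreal (sin (j * pi + pi / 2 - j * pi) - sin (j * pi - pi / 2 - j * pi))"
    by (rule nn_integral_FTC_Icc) (auto intro!: derivative_eq_intros cos_ge_zero)
  finally show ?thesis by simp
qed

lemma nn_integral_abs_cos_half_periods:
  fixes j :: int and m :: nat
  shows "(\<integral>\<^sup>+t. ennreal \<bar>cos t\<bar> * indicator {j * pi - pi / 2..(j + m) * pi - pi / 2} t \<partial>lborel) \<le> ennreal (2 * m)"
proof (induction m)
  case 0
  have "(\<integral>\<^sup>+t. ennreal \<bar>cos t\<bar> * indicator {j * pi - pi / 2..(j + (0::nat)) * pi - pi / 2} t \<partial>lborel)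
     = (\<integral>\<^sup>+t\<in>{j * pi - pi / 2}. ennreal \<bar>cos t\<bar> \<partial>lborel)"
    by simp
  also have "\<dots> = 0"
    by (rule nn_integral_null_set) (simp add: null_sets_def)
  finally show ?case by simp
next
  case (Suc m)
  have "(\<integral>\<^sup>+t. ennreal \<bar>cos t\<bar> * indicator {j * pi - pi / 2..(j + Suc m) * pi - pi / 2} t \<partial>lborel)
     \<le> (\<integral>\<^sup>+t. ennreal \<bar>cos t\<bar> * indicator {j * pi - pi / 2..(j + m) * pi - pi / 2} t
          + ennreal \<bar>cos t\<bar> * indicator {(j + int m) * pi - pi / 2..(j + int m) * pi + pi / 2} t \<partial>lborel)"
    by (intro nn_integral_mono) (auto simp: algebra_simps split: split_indicator)
  also have "\<dots> \<le> ennreal (2 * m) + 2"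
    using Suc nn_integral_abs_cos_half_period[of "j + int m"]
    by (subst nn_integral_add) (auto intro!: add_mono)
  also have "\<dots> = ennreal (2 * Suc m)"
    by (simp flip: ennreal_numeral ennreal_plus add: algebra_simps)
  finally show ?case .
qed

text \<open>
  The interval \<open>[u, v]\<close> is covered by at most \<open>(v - u) / \<pi> + 2\<close> intervals between consecutive zeros
  of the cosine, and each of them contributes exactly 2.
\<close>

lemma nn_integral_abs_cos_le:
  assumes "u \<le> v"
  shows "(\<integral>\<^sup>+t. ennreal \<bar>cos t\<bar> * indicator {u..v} t \<partial>lborel) \<le> ennreal (2 / pi * (v - u) + 4)"
proof -
  \<comment> \<open>the largest zero \<open>j\<pi> - \<pi>/2\<close> up to \<open>u\<close>, and the smallest zero \<open>(j + m)\<pi> - \<pi>/2\<close> from \<open>v\<close> on\<close>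
  define j where "j = \<lfloor>u / pi + 1 / 2\<rfloor>"
  define m where "m = nat (\<lceil>v / pi + 1 / 2\<rceil> - j)"
  have "j \<le> u / pi + 1 / 2" "u / pi + 1 / 2 < j + 1"
    unfolding j_def by linarith+
  then have j: "j * pi - pi / 2 \<le> u" "u < (j + 1) * pi - pi / 2"
    by (simp_all add: field_simps)
  have "u / pi \<le> v / pi"
    using assms by (simp add: divide_right_mono)
  then have "j \<le> \<lceil>v / pi + 1 / 2\<rceil>"
    unfolding j_def by linarith
  then have *: "j + int m = \<lceil>v / pi + 1 / 2\<rceil>"
    by (simp add: m_def)
  have "v / pi + 1 / 2 \<le> real_of_int (j + int m)" "real_of_int (j + int m) < v / pi + 1 / 2 + 1"
    unfolding * by linarith+
  then have m: "v \<le> (j + m) * pi - pi / 2" "(j + m) * pi - pi / 2 < v + pi"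
    by (simp_all add: field_simps)
  have "m * pi \<le> v - u + 2 * pi"
    using j m by (simp add: algebra_simps)
  then have 2: "2 * m \<le> 2 / pi * (v - u) + 4"
    by (simp add: field_simps)
  have "(\<integral>\<^sup>+t. ennreal \<bar>cos t\<bar> * indicator {u..v} t \<partial>lborel)
      \<le> (\<integral>\<^sup>+t. ennreal \<bar>cos t\<bar> * indicator {j * pi - pi / 2..(j + m) * pi - pi / 2} t \<partial>lborel)"
    using j m by (intro nn_integral_mono) (auto split: split_indicator)
  also have "\<dots> \<le> ennreal (2 * m)"
    using nn_integral_abs_cos_half_periods[of j m] by simp
  also have "\<dots> \<le> ennreal (2 / pi * (v - u) + 4)"
    using 2 by (intro ennreal_leI) simp
  finally show ?thesis .
qed

section \<open>The uniform distribution on an interval\<close>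

lemma space_uniform_interval [simp]: "space (uniform_interval a b) = {a..b}"
  by (simp add: uniform_interval_def space_restrict_space)

lemma sets_uniform_interval [measurable_cong]:
  "sets (uniform_interval a b) = sets (restrict_space borel {a..b})"
  by (simp add: uniform_interval_def cong: sets_restrict_space_cong)

lemma ident_measurable_uniform_interval [measurable]: "(\<lambda>x. x) \<in> uniform_interval a b \<rightarrow>\<^sub>M borel"
  unfolding measurable_cong_sets[OF sets_uniform_interval refl]
  by (rule measurable_restrict_space1) simp

lemma emeasure_Icc_uniform_interval:
  assumes "a < b"
  shows "emeasure (restrict_space lborel {a..b}) {a..b} = ennreal (b - a)"
  using assms by (subst emeasure_restrict_space) auto

lemma prob_space_uniform_interval:
  assumes "a < b"
  shows "prob_space (uniform_interval a b)"
  unfolding uniform_interval_def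
  by (intro prob_space_uniform_measure)
     (use assms in \<open>simp_all add: emeasure_Icc_uniform_interval\<close>)

lemma nn_integral_uniform_interval:
  assumes "a < b" and [measurable]: "f \<in> borel_measurable borel"
  shows "(\<integral>\<^sup>+x. f x \<partial>uniform_interval a b)
    = (\<integral>\<^sup>+x. f x * indicator {a..b} x \<partial>lborel) / ennreal (b - a)"
proof -
  have "f \<in> borel_measurable (restrict_space lborel {a..b})"
    by (rule measurable_restrict_space1) simp
  then show ?thesis
    unfolding uniform_interval_def using assms(1)
    by (subst nn_integral_uniform_measure)
       (auto simp: emeasure_Icc_uniform_interval sets_restrict_space_iff nn_integral_restrict_space
          intro!: arg_cong2[where f = "(/)"] nn_integral_cong split: split_indicator)
qed

text \<open>
  Equidistribution of the phase: once \<open>y\<close> is large, \<open>y * x\<close> runs through many periods, and so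
  the mean of \<open>\<bar>cos\<bar>\<close> is close to its mean \<open>2 / \<pi>\<close> over a period.  This is where the constant
  of the theorem comes from.
\<close>

lemma nn_integral_abs_cos_uniform_interval_le:
  assumes "a < b" and "y \<noteq> 0"
  shows "(\<integral>\<^sup>+x. ennreal \<bar>cos (pi * (y * x))\<bar> \<partial>uniform_interval a b)
    \<le> ennreal (2 / pi + 4 / (pi * \<bar>y\<bar> * (b - a)))"
proof -
  define z where "z = pi * \<bar>y\<bar>"
  have z: "z > 0" using assms by (simp add: z_def)
  have "\<bar>cos (pi * (y * x))\<bar> = \<bar>cos (z * x)\<bar>" for x
    unfolding z_def by (cases "y \<ge> 0") (auto simp: mult.assoc)
  then have "(\<integral>\<^sup>+x. ennreal \<bar>cos (pi * (y * x))\<bar> \<partial>uniform_interval a b)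
      = (\<integral>\<^sup>+x. ennreal \<bar>cos (z * x)\<bar> * indicator {a..b} x \<partial>lborel) / ennreal (b - a)"
    using assms by (simp add: nn_integral_uniform_interval)
  also have "\<dots> \<le> ennreal (1 / z) * ennreal (2 / pi * (z * b - z * a) + 4) / ennreal (b - a)"
  proof (intro divide_right_mono_ennreal)
    have "(\<integral>\<^sup>+x. ennreal \<bar>cos (z * x)\<bar> * indicator {a..b} x \<partial>lborel)
       = ennreal (1 / z) * (ennreal z * (\<integral>\<^sup>+x. ennreal \<bar>cos (z * x)\<bar> * indicator {a..b} x \<partial>lborel))"
      using z by (simp flip: mult.assoc ennreal_mult)
    also have "ennreal z * (\<integral>\<^sup>+x. ennreal \<bar>cos (z * x)\<bar> * indicator {a..b} x \<partial>lborel)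
       = ennreal \<bar>z\<bar> * (\<integral>\<^sup>+x. ennreal \<bar>cos (0 + z * x)\<bar> * indicator {z * a..z * b} (0 + z * x) \<partial>lborel)"
      using z by (auto intro!: arg_cong2[where f = "(*)"] nn_integral_cong split: split_indicator)
    also have "\<dots> = (\<integral>\<^sup>+t. ennreal \<bar>cos t\<bar> * indicator {z * a..z * b} t \<partial>lborel)"
      using z by (intro nn_integral_real_affine[symmetric]) auto
    also have "\<dots> \<le> ennreal (2 / pi * (z * b - z * a) + 4)"
      using z assms by (intro nn_integral_abs_cos_le) auto
    finally show "(\<integral>\<^sup>+x. ennreal \<bar>cos (z * x)\<bar> * indicator {a..b} x \<partial>lborel)
        \<le> ennreal (1 / z) * ennreal (2 / pi * (z * b - z * a) + 4)"
      by (simp add: mult_left_mono)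
  qed
  also have "\<dots> = ennreal ((1 / z) * (2 / pi * (z * b - z * a) + 4) / (b - a))"
  proof -
    have "0 \<le> 2 / pi * (z * b - z * a) + 4"
      using z assms by auto
    then show ?thesis
      using z assms(1) by (subst ennreal_mult[symmetric] divide_ennreal; simp)+
  qed
  also have "(1 / z) * (2 / pi * (z * b - z * a) + 4) / (b - a) = 2 / pi + 4 / (pi * \<bar>y\<bar> * (b - a))"
    using z assms by (simp add: z_def field_simps)
  finally show ?thesis .
qed

section \<open>Products of cosines along random ratios\<close>

definition ratio_prod :: "(nat \<Rightarrow> real) \<Rightarrow> nat \<Rightarrow> real" where
  "ratio_prod \<omega> n = (\<Prod>k<n. \<omega> k)"

definition cos_prod :: "(nat \<Rightarrow> real) \<Rightarrow> real \<Rightarrow> nat \<Rightarrow> real" where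
  "cos_prod \<omega> \<xi> n = (\<Prod>k<n. \<bar>cos (pi * (\<xi> * ratio_prod \<omega> (Suc k)))\<bar>)"

lemma ratio_prod_0 [simp]: "ratio_prod \<omega> 0 = 1"
  by (simp add: ratio_prod_def)

lemma ratio_prod_case_nat [simp]: "ratio_prod (case_nat x \<omega>) (Suc n) = x * ratio_prod \<omega> n"
  by (simp add: ratio_prod_def prod.lessThan_Suc_shift del: prod.lessThan_Suc)

lemma cos_prod_0 [simp]: "cos_prod \<omega> \<xi> 0 = 1"
  by (simp add: cos_prod_def)

lemma cos_prod_case_nat:
  "cos_prod (case_nat x \<omega>) \<xi> (Suc n) = \<bar>cos (pi * (\<xi> * x))\<bar> * cos_prod \<omega> (\<xi> * x) n"
  by (simp add: cos_prod_def prod.lessThan_Suc_shift mult.assoc del: prod.lessThan_Suc)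

lemma cos_prod_nonneg [simp]: "0 \<le> cos_prod \<omega> \<xi> n"
  by (simp add: cos_prod_def prod_nonneg)

text \<open>
  Fixing the parameters in a locale makes the general theory of product measures over the
  naturals available for the law of the ratios.
\<close>

locale random_ratios =
  fixes a b :: real
  assumes a_pos: "0 < a" and a_less_b: "a < b" and b_less_1: "b < 1"
begin

sublocale sequence_space "uniform_interval a b"
  by (intro sequence_space.intro product_prob_space.intro product_prob_space_axioms.intro
      product_sigma_finite.intro prob_space_imp_sigma_finite prob_space_uniform_interval a_less_b)

lemma ratio_measure_eq: "ratio_measure a b = S"
  by (simp add: ratio_measure_def)

lemma space_ratios: "\<omega> \<in> space S \<longleftrightarrow> (\<forall>k. \<omega> k \<in> {a..b})"
  by (auto simp: space_PiM)

lemma ratio_measurable [measurable]: "(\<lambda>\<omega>. \<omega> k) \<in> borel_measurable S"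
proof -
  have "(\<lambda>\<omega>. \<omega> k) \<in> S \<rightarrow>\<^sub>M uniform_interval a b" by simp
  then show ?thesis
    by (rule measurable_compose) (rule ident_measurable_uniform_interval)
qed

lemma ratio_prod_measurable [measurable]: "(\<lambda>\<omega>. ratio_prod \<omega> n) \<in> borel_measurable S"
  unfolding ratio_prod_def by measurable

lemma ratio_prod_pos: "\<omega> \<in> space S \<Longrightarrow> 0 < ratio_prod \<omega> n"
  unfolding ratio_prod_def using a_pos by (force intro!: prod_pos simp: space_ratios intro: less_le_trans)

lemma ratio_prod_le_power: "\<omega> \<in> space S \<Longrightarrow> ratio_prod \<omega> n \<le> b ^ n"
  unfolding ratio_prod_def using a_pos prod_mono[of "{..<n}" \<omega> "\<lambda>_. b"]
  by (force simp: space_ratios intro: order_trans[OF less_imp_le])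

lemma cos_prod_measurable [measurable]: "(\<lambda>(\<omega>, \<xi>). cos_prod \<omega> \<xi> n) \<in> borel_measurable (S \<Otimes>\<^sub>M borel)"
  unfolding cos_prod_def by measurable

text \<open>
  Conditioning on the first ratio: the remaining ratios are distributed like the whole sequence.
\<close>

lemma nn_integral_iter:
  assumes [measurable]: "f \<in> borel_measurable S"
  shows "(\<integral>\<^sup>+\<omega>. f \<omega> \<partial>S) = (\<integral>\<^sup>+x. \<integral>\<^sup>+\<omega>. f (case_nat x \<omega>) \<partial>S \<partial>uniform_interval a b)"
proof -
  have "(\<integral>\<^sup>+\<omega>. f \<omega> \<partial>S) = (\<integral>\<^sup>+z. f ((\<lambda>(x, \<omega>). case_nat x \<omega>) z) \<partial>(uniform_interval a b \<Otimes>\<^sub>M S))"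
    by (subst PiM_iter[symmetric], rule nn_integral_distr) measurable
  also have "\<dots> = (\<integral>\<^sup>+x. \<integral>\<^sup>+\<omega>. f (case_nat x \<omega>) \<partial>S \<partial>uniform_interval a b)"
    by (subst nn_integral_fst[symmetric]) auto
  finally show ?thesis .
qed

text \<open>
  The event \<open>T \<le> \<bar>\<xi>\<bar> * ratio_prod \<omega> n\<close> says that the frequency is still at least \<open>T\<close> after
  rescaling by all \<open>n\<close> ratios; as ratios are below 1, it then was at least \<open>T\<close> at each earlier step.
  After the first ratio \<open>x\<close>, both the product and the event reproduce themselves for the remaining
  ratios with \<open>\<xi> * x\<close> instead of \<open>\<xi>\<close>.  Hence an induction that leaves the frequency arbitrary
  gains one factor \<open>q\<close> from the first cosine and the others from the rest.
\<close>

lemma nn_integral_cos_prod_le: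
  assumes q: "\<And>y. T \<le> \<bar>y\<bar> \<Longrightarrow> (\<integral>\<^sup>+x. ennreal \<bar>cos (pi * (y * x))\<bar> \<partial>uniform_interval a b) \<le> q"
  shows "(\<integral>\<^sup>+\<omega>. ennreal (cos_prod \<omega> \<xi> n) * indicator {\<omega>. T \<le> \<bar>\<xi>\<bar> * ratio_prod \<omega> n} \<omega> \<partial>S) \<le> q ^ n"
proof (induction n arbitrary: \<xi>)
  case 0
  have "(\<integral>\<^sup>+\<omega>. indicator {\<omega>. T \<le> \<bar>\<xi>\<bar> * ratio_prod \<omega> 0} \<omega> \<partial>S) \<le> (\<integral>\<^sup>+\<omega>. 1 \<partial>S)"
    by (intro nn_integral_mono) (auto split: split_indicator)
  then show ?case
    by (simp add: emeasure_space_1)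
next
  case (Suc n)
  \<comment> \<open>for \<open>\<bar>\<xi>\<bar> < T\<close> the event is empty, so \<open>q\<close> is only needed at frequencies of size at least \<open>T\<close>\<close>
  show ?case
  proof (cases "T \<le> \<bar>\<xi>\<bar>")
    case True
    have "(\<integral>\<^sup>+\<omega>. ennreal (cos_prod \<omega> \<xi> (Suc n)) * indicator {\<omega>. T \<le> \<bar>\<xi>\<bar> * ratio_prod \<omega> (Suc n)} \<omega> \<partial>S)
      = (\<integral>\<^sup>+x. \<integral>\<^sup>+\<omega>. ennreal (cos_prod (case_nat x \<omega>) \<xi> (Suc n))
            * indicator {\<omega>. T \<le> \<bar>\<xi>\<bar> * ratio_prod \<omega> (Suc n)} (case_nat x \<omega>) \<partial>S \<partial>uniform_interval a b)"
      by (rule nn_integral_iter) measurable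
    also have "\<dots> = (\<integral>\<^sup>+x. \<integral>\<^sup>+\<omega>. ennreal \<bar>cos (pi * (\<xi> * x))\<bar> * (ennreal (cos_prod \<omega> (\<xi> * x) n)
            * indicator {\<omega>. T \<le> \<bar>\<xi> * x\<bar> * ratio_prod \<omega> n} \<omega>) \<partial>S \<partial>uniform_interval a b)"
      using a_pos by (intro nn_integral_cong)
        (auto simp: cos_prod_case_nat ennreal_mult abs_mult mult.assoc split: split_indicator)
    also have "\<dots> = (\<integral>\<^sup>+x. ennreal \<bar>cos (pi * (\<xi> * x))\<bar> * (\<integral>\<^sup>+\<omega>. ennreal (cos_prod \<omega> (\<xi> * x) n)
            * indicator {\<omega>. T \<le> \<bar>\<xi> * x\<bar> * ratio_prod \<omega> n} \<omega> \<partial>S) \<partial>uniform_interval a b)"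
      by (intro nn_integral_cong nn_integral_cmult) measurable
    also have "\<dots> \<le> (\<integral>\<^sup>+x. ennreal \<bar>cos (pi * (\<xi> * x))\<bar> * q ^ n \<partial>uniform_interval a b)"
      by (intro nn_integral_mono mult_left_mono Suc.IH) auto
    also have "\<dots> = (\<integral>\<^sup>+x. ennreal \<bar>cos (pi * (\<xi> * x))\<bar> \<partial>uniform_interval a b) * q ^ n"
      by (rule nn_integral_multc) measurable
    also have "\<dots> \<le> q * q ^ n"
      by (intro mult_right_mono q True) auto
    finally show ?thesis by simp
  next
    case False
    have "\<not> T \<le> \<bar>\<xi>\<bar> * ratio_prod \<omega> (Suc n)" if "\<omega> \<in> space S" for \<omega>
    proof -
      have "b ^ Suc n \<le> 1"
        using a_pos a_less_b b_less_1 by (intro power_le_one) auto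
      then have "ratio_prod \<omega> (Suc n) \<le> 1"
        using ratio_prod_le_power[OF that, of "Suc n"] by linarith
      then have "\<bar>\<xi>\<bar> * ratio_prod \<omega> (Suc n) \<le> \<bar>\<xi>\<bar> * 1"
        by (intro mult_left_mono) auto
      with False show ?thesis by simp
    qed
    then have "(\<integral>\<^sup>+\<omega>. ennreal (cos_prod \<omega> \<xi> (Suc n)) * indicator {\<omega>. T \<le> \<bar>\<xi>\<bar> * ratio_prod \<omega> (Suc n)} \<omega> \<partial>S)
      = (\<integral>\<^sup>+\<omega>. 0 \<partial>S)"
      by (intro nn_integral_cong) auto
    then show ?thesis by simp
  qed
qed

end

section \<open>The Fourier transform as a product of cosines\<close>

definition random_series :: "(nat \<Rightarrow> real) \<Rightarrow> (nat \<Rightarrow> bool) \<Rightarrow> real" where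
  "random_series \<omega> a = (\<Sum>j. of_bool (a j) * ratio_prod \<omega> (Suc j))"

interpretation coins: sequence_space "measure_pmf (bernoulli_pmf (1 / 2))"
  by (intro sequence_space.intro product_prob_space.intro product_prob_space_axioms.intro
      product_sigma_finite.intro prob_space_imp_sigma_finite prob_space_measure_pmf)

lemma coin_measure_eq: "coin_measure = coins.S"
  by (simp add: coin_measure_def)

lemma random_series_measurable [measurable]: "random_series \<omega> \<in> borel_measurable coins.S"
  unfolding random_series_def by measurable

lemma random_bernoulli_convolution_eq:
  "random_bernoulli_convolution \<omega> = distr coins.S borel (random_series \<omega>)"
  unfolding random_bernoulli_convolution_def coin_measure_eq random_series_def ratio_prod_def
    lessThan_Suc_atMost ..

lemma prob_space_random_bernoulli_convolution: "prob_space (random_bernoulli_convolution \<omega>)"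
  unfolding random_bernoulli_convolution_eq by (rule coins.prob_space_distr) measurable

lemma fourier_transform_measurable:
  assumes "prob_space \<mu>" and [measurable_cong]: "sets \<mu> = sets borel"
  shows "fourier_transform \<mu> \<in> borel_measurable borel"
proof -
  interpret prob_space \<mu> by fact
  show ?thesis
    unfolding fourier_transform_def[abs_def] by measurable
qed

lemma norm_fourier_transform_le_1:
  assumes "prob_space \<mu>"
  shows "norm (fourier_transform \<mu> \<xi>) \<le> 1"
proof -
  interpret prob_space \<mu> by fact
  have "norm (exp (- 2 * of_real pi * \<i> * of_real \<xi> * of_real x)) = 1" for x :: real
    by (simp add: norm_exp_eq_Re)
  then show ?thesis
    using integral_norm_bound[of \<mu> "\<lambda>x. exp (- 2 * of_real pi * \<i> * of_real \<xi> * of_real x)"]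
    by (simp only: fourier_transform_def lebesgue_integral_const prob_space scaleR_one)
qed

lemma norm_half_1_plus_cis: "norm ((1 + exp (- 2 * of_real pi * \<i> * of_real t)) / 2) = \<bar>cos (pi * t)\<bar>"
proof -
  have "1 + exp (- 2 * of_real pi * \<i> * of_real t) = 2 * of_real (cos (pi * t)) * cis (- (pi * t))"
    by (simp add: complex_eq_iff cos_double_cos sin_double Re_exp Im_exp power2_eq_square
        mult.assoc[of 2 pi t])
  then show ?thesis by (simp add: norm_mult)
qed

context random_ratios
begin

lemma summable_random_series:
  assumes "\<omega> \<in> space S"
  shows "summable (\<lambda>j. of_bool (a' j) * ratio_prod \<omega> (Suc j))"
proof (rule summable_comparison_test')
  show "summable (\<lambda>n. b ^ Suc n)"
    using a_pos a_less_b b_less_1 by (subst summable_Suc_iff) (auto intro: summable_geometric)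
  show "norm (of_bool (a' n) * ratio_prod \<omega> (Suc n)) \<le> b ^ Suc n" if "0 \<le> n" for n
    using ratio_prod_le_power[OF assms, of "Suc n"] ratio_prod_pos[OF assms, of "Suc n"]
    by (cases "a' n") (auto simp del: power_Suc)
qed

text \<open>
  The random series is self-similar; the bit \<open>c\<close> and the ratio \<open>x\<close> are the first ones.
\<close>

lemma random_series_case_nat:
  assumes "\<omega> \<in> space S" "x \<in> {a..b}"
  shows "random_series (case_nat x \<omega>) (case_nat c a') = x * of_bool c + x * random_series \<omega> a'"
proof -
  have "case_nat x \<omega> \<in> space S"
    using assms by (auto simp: space_ratios split: nat.split)
  note suminf_split_head[OF summable_random_series[OF this, of "case_nat c a'"]]
  then have "random_series (case_nat x \<omega>) (case_nat c a')
      = (\<Sum>j. of_bool (a' j) * ratio_prod (case_nat x \<omega>) (Suc (Suc j))) + x * of_bool c"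
    unfolding random_series_def by (simp add: mult.commute algebra_simps)
  also have "(\<Sum>j. of_bool (a' j) * ratio_prod (case_nat x \<omega>) (Suc (Suc j))) = x * random_series \<omega> a'"
    unfolding random_series_def
    by (subst suminf_mult[symmetric, OF summable_random_series[OF assms(1)]]) (simp add: mult_ac)
  finally show ?thesis by simp
qed

text \<open>
  Integrating the self-similarity of the random series over the first coin toss splits off the
  Fourier transform of the first two-point measure and rescales the frequency of the remainder.
\<close>

lemma fourier_transform_case_nat:
  assumes \<omega>: "\<omega> \<in> space S" and x: "x \<in> {a..b}"
  shows "fourier_transform (random_bernoulli_convolution (case_nat x \<omega>)) \<xi>
    = (1 + exp (- 2 * of_real pi * \<i> * of_real (\<xi> * x))) / 2
      * fourier_transform (random_bernoulli_convolution \<omega>) (\<xi> * x)"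
proof -
  define e where "e = (\<lambda>t::real. exp (- 2 * of_real pi * \<i> * of_real t))"
  have e_add: "e (s + t) = e s * e t" for s t
    by (simp add: e_def exp_add[symmetric] algebra_simps)
  have norm_e: "norm (e t) = 1" for t
    by (simp add: e_def norm_exp_eq_Re)
  have [measurable]: "e \<in> borel_measurable borel"
    unfolding e_def by measurable
  have F: "fourier_transform (random_bernoulli_convolution \<omega>) \<xi> = (\<integral>a'. e (\<xi> * random_series \<omega> a') \<partial>coins.S)"
    for \<omega> \<xi>
    unfolding fourier_transform_def random_bernoulli_convolution_eq
    by (subst integral_distr) (auto simp: e_def mult.assoc)
  interpret toss: pair_prob_space "measure_pmf (bernoulli_pmf (1 / 2))" coins.S ..
  let ?f = "\<lambda>a'. e (\<xi> * random_series (case_nat x \<omega>) a')"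
  have "(\<integral>a'. ?f a' \<partial>coins.S)
      = (\<integral>z. ?f (case z of (c, a') \<Rightarrow> case_nat c a') \<partial>(measure_pmf (bernoulli_pmf (1 / 2)) \<Otimes>\<^sub>M coins.S))"
    by (subst (1) coins.PiM_iter[symmetric], rule integral_distr) measurable
  also have "\<dots> = (\<integral>c. \<integral>a'. ?f (case_nat c a') \<partial>coins.S \<partial>measure_pmf (bernoulli_pmf (1 / 2)))"
  proof (subst toss.integral_fst'[symmetric])
    show "integrable (measure_pmf (bernoulli_pmf (1 / 2)) \<Otimes>\<^sub>M coins.S)
       (\<lambda>z. ?f (case z of (c, a') \<Rightarrow> case_nat c a'))"
      by (rule toss.integrable_const_bound[where B = 1]) (auto simp: norm_e)
  qed simp
  also have "\<dots> = (\<integral>c. e (\<xi> * x * of_bool c) * (\<integral>a'. e (\<xi> * x * random_series \<omega> a') \<partial>coins.S)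
      \<partial>measure_pmf (bernoulli_pmf (1 / 2)))"
    by (simp add: random_series_case_nat[OF assms] distrib_left e_add mult.assoc)
  also have "\<dots> = (1 + e (\<xi> * x)) / 2 * (\<integral>a'. e (\<xi> * x * random_series \<omega> a') \<partial>coins.S)"
    by (subst integral_measure_pmf[of UNIV])
       (auto simp: UNIV_bool e_def scaleR_conv_of_real field_simps)
  finally show ?thesis
    unfolding F by (simp add: e_def)
qed

text \<open>
  Iterating the previous identity and bounding the remaining factor by 1: a finite part of the
  infinite product that represents the Fourier transform is an upper bound.
\<close>

lemma norm_fourier_transform_le_cos_prod:
  assumes "\<omega> \<in> space S"
  shows "norm (fourier_transform (random_bernoulli_convolution \<omega>) \<xi>) \<le> cos_prod \<omega> \<xi> n"
  using assms
proof (induction n arbitrary: \<omega> \<xi>)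
  case 0
  then show ?case
    by (simp add: norm_fourier_transform_le_1 prob_space_random_bernoulli_convolution)
next
  case (Suc n)
  define \<omega>' where "\<omega>' = (\<lambda>k. \<omega> (Suc k))"
  have \<omega>: "\<omega> = case_nat (\<omega> 0) \<omega>'"
    by (auto simp: \<omega>'_def fun_eq_iff split: nat.split)
  have \<omega>': "\<omega>' \<in> space S" "\<omega> 0 \<in> {a..b}"
    using Suc.prems by (auto simp: space_ratios \<omega>'_def)
  have "norm (fourier_transform (random_bernoulli_convolution (case_nat (\<omega> 0) \<omega>')) \<xi>)
      \<le> cos_prod (case_nat (\<omega> 0) \<omega>') \<xi> (Suc n)"
    unfolding fourier_transform_case_nat[OF \<omega>'] norm_mult norm_half_1_plus_cis cos_prod_case_nat
    by (intro mult_left_mono Suc.IH \<omega>') simp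
  then show ?case
    by (simp only: \<omega>[symmetric])
qed

end

section \<open>Exponential lower bounds for products of ratios\<close>

context random_ratios
begin

lemma ratio_pos: "\<omega> \<in> space S \<Longrightarrow> 0 < \<omega> k"
  using a_pos by (auto simp: space_ratios intro: less_le_trans)

lemma ln_ratio_bounds: "\<omega> \<in> space S \<Longrightarrow> ln (\<omega> k) \<in> {ln a..ln b}"
  using a_pos ratio_pos[of \<omega> k] a_less_b by (simp add: space_ratios)

lemma distr_ratio: "distr S (uniform_interval a b) (\<lambda>\<omega>. \<omega> k) = uniform_interval a b"
  by (rule PiM_component) simp

lemma indep_vars_ln_ratios:
  assumes "I \<noteq> {}" "finite I"
  shows "P.indep_vars (\<lambda>_. borel) (\<lambda>k \<omega>. ln (\<omega> k)) I"
proof (rule P.indep_vars_compose2[where M' = "\<lambda>_. uniform_interval a b"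
      and X = "\<lambda>k \<omega>. \<omega> k" and Y = "\<lambda>_. ln"])
  have "distr S (Pi\<^sub>M I (\<lambda>_. uniform_interval a b)) (\<lambda>\<omega>. restrict \<omega> I)
      = (\<Pi>\<^sub>M k\<in>I. distr S (uniform_interval a b) (\<lambda>\<omega>. \<omega> k))"
    using distr_PiM_restrict_finite[OF assms(2)] by (simp only: distr_ratio subset_UNIV)
  then show "P.indep_vars (\<lambda>_. uniform_interval a b) (\<lambda>k \<omega>. \<omega> k) I"
    by (subst P.indep_vars_iff_distr_eq_PiM'[OF assms(1)]) (rule measurable_component_singleton, simp)
  show "ln \<in> uniform_interval a b \<rightarrow>\<^sub>M borel" for k
    by (rule borel_measurable_ln) (rule ident_measurable_uniform_interval)
qed

text \<open>
  The strong law of large numbers for \<open>ln (\<omega> k)\<close>, in the one-sided form that is needed: Hoeffding's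
  inequality makes the probability of \<open>ratio_prod \<omega> n < c ^ n\<close> exponentially small, and the
  Borel-Cantelli lemma applies.
\<close>

lemma AE_eventually_ratio_prod_ge:
  assumes c: "0 < c" "c < geometric_mean_ratio a b"
  shows "AE \<omega> in S. eventually (\<lambda>n. c ^ n \<le> ratio_prod \<omega> n) sequentially"
proof -
  define \<mu> where "\<mu> = (\<integral>\<omega>. ln (\<omega> 0) \<partial>S)"
  define \<delta> where "\<delta> = \<mu> - ln c"
  define L where "L = ln b - ln a"
  have "ln c < \<mu>"
    using c by (subst exp_less_cancel_iff[symmetric])
      (simp add: geometric_mean_ratio_def ratio_measure_eq \<mu>_def)
  then have \<delta>: "\<delta> > 0" by (simp add: \<delta>_def)
  have L: "L > 0" using a_pos a_less_b by (simp add: L_def)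
  define A where "A = (\<lambda>n. {\<omega> \<in> space S. (\<Sum>k<n. ln (\<omega> k)) \<le> n * \<mu> - n * \<delta>})"
  have [measurable]: "A n \<in> sets S" for n
    unfolding A_def by measurable
  have A_le: "P.prob (A n) \<le> exp (- 2 * \<delta>\<^sup>2 / L\<^sup>2) ^ n" for n
  proof (cases "n = 0")
    case False
    have distr: "distr S borel (\<lambda>\<omega>. ln (\<omega> k)) = distr (uniform_interval a b) borel ln" for k
      by (subst (2) distr_ratio[symmetric, of k], subst distr_distr) (auto simp: o_def)
    interpret Hoeffding_ineq_iid S "{..<n}" "\<lambda>k \<omega>. ln (\<omega> k)" "\<lambda>\<omega>. ln (\<omega> 0)" "ln a" "ln b" \<mu>
    proof unfold_locales
      show "AE \<omega> in S. ln (\<omega> 0) \<in> {ln a..ln b}"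
        by (intro AE_I2 ln_ratio_bounds)
      show "P.indep_vars (\<lambda>_. borel) (\<lambda>k \<omega>. ln (\<omega> k)) {..<n}"
        using False by (intro indep_vars_ln_ratios) (auto simp: lessThan_empty_iff)
      show "distr S borel (\<lambda>\<omega>. ln (\<omega> k)) = distr S borel (\<lambda>\<omega>. ln (\<omega> 0))" for k
        unfolding distr ..
    qed (simp_all add: \<mu>_def)
    have "P.prob (A n) \<le> exp (- 2 * (n * \<delta>)\<^sup>2 / (n * L\<^sup>2))"
    proof -
      have "P.prob {\<omega> \<in> space S. (\<Sum>k<n. ln (\<omega> k)) \<le> card {..<n} * \<mu> - n * \<delta>}
          \<le> exp (- 2 * (n * \<delta>)\<^sup>2 / (card {..<n} * (ln b - ln a)\<^sup>2))"
        using False \<delta> a_pos a_less_b by (intro Hoeffding_ineq_le) (auto simp: lessThan_empty_iff)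
      then show ?thesis by (simp only: A_def L_def card_lessThan)
    qed
    also have "- 2 * (n * \<delta>)\<^sup>2 / (n * L\<^sup>2) = n * (- 2 * \<delta>\<^sup>2 / L\<^sup>2)"
      using False L by (simp add: field_simps power2_eq_square)
    finally show ?thesis
      by (simp only: exp_of_nat_mult)
  qed simp
  have "AE \<omega> in S. eventually (\<lambda>n. \<omega> \<in> space S - A n) sequentially"
  proof (rule borel_cantelli_AE1)
    show "summable (\<lambda>n. P.prob (A n))"
    proof (rule summable_comparison_test')
      show "summable (\<lambda>n. exp (- 2 * \<delta>\<^sup>2 / L\<^sup>2) ^ n)"
        using \<delta> L by (intro summable_geometric) simp
    qed (use A_le in auto)
  qed (auto simp: P.emeasure_eq_measure)
  then show ?thesis
  proof (rule AE_mp, intro AE_I2 impI)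
    fix \<omega> assume "eventually (\<lambda>n. \<omega> \<in> space S - A n) sequentially"
    then show "eventually (\<lambda>n. c ^ n \<le> ratio_prod \<omega> n) sequentially"
    proof (rule eventually_mono)
      fix n assume "\<omega> \<in> space S - A n"
      then have \<omega>: "\<omega> \<in> space S" and "n * ln c < (\<Sum>k<n. ln (\<omega> k))"
        by (auto simp: A_def \<delta>_def algebra_simps)
      then have "exp (n * ln c) \<le> exp (\<Sum>k<n. ln (\<omega> k))" by simp
      also have "\<dots> = ratio_prod \<omega> n"
        using ratio_pos[OF \<omega>] by (simp add: exp_sum ratio_prod_def)
      finally show "c ^ n \<le> ratio_prod \<omega> n"
        using c by (simp add: exp_of_nat_mult)
    qed
  qed
qed

end

section \<open>Integrability of the Fourier transform\<close>

text \<open>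
  A frequency with \<open>T / c ^ n \<le> \<bar>\<xi>\<bar> \<le> T / c ^ Suc n\<close> should be treated with \<open>n\<close> cosine factors.
  Summing over all \<open>n\<close> that meet the upper bound and for which the frequency stays at least \<open>T\<close> after
  \<open>n\<close> rescalings, instead of choosing one \<open>n\<close> for each \<open>\<xi>\<close>, gives a function that is visibly
  measurable in both arguments and can be integrated term by term.
\<close>

definition cos_majorant :: "real \<Rightarrow> real \<Rightarrow> (nat \<Rightarrow> real) \<Rightarrow> real \<Rightarrow> ennreal" where
  "cos_majorant T c \<omega> \<xi> = (\<Sum>n. ennreal (cos_prod \<omega> \<xi> n)
      * indicator {\<omega>. T \<le> \<bar>\<xi>\<bar> * ratio_prod \<omega> n} \<omega>
      * indicator {- (T / c ^ Suc n)..T / c ^ Suc n} \<xi>)"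

context random_ratios
begin

text \<open>
  By Tonelli's theorem the expected integral is at most the sum over \<open>n\<close> of the length
  \<open>2 * T / c ^ Suc n\<close> of the frequency range times the expectation bound \<open>q ^ n\<close>: a geometric series
  of ratio \<open>q / c\<close>.
\<close>

lemma AE_nn_integral_cos_majorant_finite:
  fixes q :: real
  assumes T: "0 < T" and c: "0 < c" and q: "0 \<le> q" "q < c"
    and mean: "\<And>y. T \<le> \<bar>y\<bar> \<Longrightarrow>
      (\<integral>\<^sup>+x. ennreal \<bar>cos (pi * (y * x))\<bar> \<partial>uniform_interval a b) \<le> ennreal q"
  shows "AE \<omega> in S. (\<integral>\<^sup>+\<xi>. cos_majorant T c \<omega> \<xi> \<partial>lborel) \<noteq> \<infinity>"
  unfolding cos_majorant_def
proof (rule nn_integral_noteq_infinite)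
  let ?h = "\<lambda>n \<omega> \<xi>. ennreal (cos_prod \<omega> \<xi> n) * indicator {\<omega>. T \<le> \<bar>\<xi>\<bar> * ratio_prod \<omega> n} \<omega>"
  let ?I = "\<lambda>n. {- (T / c ^ Suc n)..T / c ^ Suc n}"
  interpret shells: pair_sigma_finite S lborel ..
  show "(\<integral>\<^sup>+\<omega>. (\<integral>\<^sup>+\<xi>. (\<Sum>n. ?h n \<omega> \<xi> * indicator (?I n) \<xi>) \<partial>lborel) \<partial>S) \<noteq> \<infinity>"
  proof -
    have "(\<integral>\<^sup>+\<omega>. (\<integral>\<^sup>+\<xi>. (\<Sum>n. ?h n \<omega> \<xi> * indicator (?I n) \<xi>) \<partial>lborel) \<partial>S)
        = (\<integral>\<^sup>+\<xi>. (\<integral>\<^sup>+\<omega>. (\<Sum>n. ?h n \<omega> \<xi> * indicator (?I n) \<xi>) \<partial>S) \<partial>lborel)"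
      by (rule shells.Fubini'[symmetric]) measurable
    also have "\<dots> = (\<integral>\<^sup>+\<xi>. (\<Sum>n. (\<integral>\<^sup>+\<omega>. ?h n \<omega> \<xi> \<partial>S) * indicator (?I n) \<xi>) \<partial>lborel)"
      by (subst nn_integral_suminf) (simp_all add: nn_integral_multc)
    also have "\<dots> \<le> (\<integral>\<^sup>+\<xi>. (\<Sum>n. ennreal q ^ n * indicator (?I n) \<xi>) \<partial>lborel)"
      by (intro nn_integral_mono suminf_le mult_right_mono nn_integral_cos_prod_le mean) auto
    also have "\<dots> = (\<Sum>n. ennreal q ^ n * emeasure lborel (?I n))"
      by (subst nn_integral_suminf) (simp_all add: nn_integral_cmult_indicator)
    also have "\<dots> = (\<Sum>n. ennreal (2 * T / c * (q / c) ^ n))"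
    proof (intro suminf_cong)
      fix n
      have "ennreal q ^ n * emeasure lborel (?I n) = ennreal (q ^ n) * ennreal (2 * (T / c ^ Suc n))"
        using T c q by (subst emeasure_lborel_Icc) (auto simp: ennreal_power simp del: power_Suc)
      also have "\<dots> = ennreal (q ^ n * (2 * (T / c ^ Suc n)))"
        using T c q by (subst ennreal_mult) auto
      also have "q ^ n * (2 * (T / c ^ Suc n)) = 2 * T / c * (q / c) ^ n"
        using c by (simp add: power_divide field_simps)
      finally show "ennreal q ^ n * emeasure lborel (?I n) = ennreal (2 * T / c * (q / c) ^ n)" .
    qed
    also have "\<dots> = ennreal (\<Sum>n. 2 * T / c * (q / c) ^ n)"
      using T c q by (intro suminf_ennreal2 summable_mult summable_geometric) auto
    also have "\<dots> < \<infinity>" by simp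
    finally show ?thesis by simp
  qed
qed measurable

text \<open>
  If \<open>c ^ n \<le> ratio_prod \<omega> n\<close> for \<open>n \<ge> N\<close>, then a frequency \<open>\<xi>\<close> outside the bounded interval
  \<open>\<bar>\<xi>\<bar> \<le> T / c ^ N\<close> has some \<open>n \<ge> N\<close> with \<open>T / c ^ n < \<bar>\<xi>\<bar> \<le> T / c ^ Suc n\<close>, and the term of
  index \<open>n\<close> of the majorant dominates the Fourier transform.
\<close>

lemma integrable_fourier_transform:
  assumes \<omega>: "\<omega> \<in> space S" and T: "0 < T" and c: "0 < c" "c < 1"
    and ev: "eventually (\<lambda>n. c ^ n \<le> ratio_prod \<omega> n) sequentially"
    and fin: "(\<integral>\<^sup>+\<xi>. cos_majorant T c \<omega> \<xi> \<partial>lborel) \<noteq> \<infinity>"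
  shows "integrable lborel (fourier_transform (random_bernoulli_convolution \<omega>))"
proof -
  let ?F = "fourier_transform (random_bernoulli_convolution \<omega>)"
  let ?h = "\<lambda>n \<xi>. ennreal (cos_prod \<omega> \<xi> n) * indicator {\<omega>. T \<le> \<bar>\<xi>\<bar> * ratio_prod \<omega> n} \<omega>
      * indicator {- (T / c ^ Suc n)..T / c ^ Suc n} \<xi>"
  obtain N where N: "\<And>n. N \<le> n \<Longrightarrow> c ^ n \<le> ratio_prod \<omega> n"
    using ev by (auto simp: eventually_sequentially)
  let ?R = "T / c ^ N"
  have [measurable]: "(\<lambda>\<xi>. cos_prod \<omega> \<xi> n) \<in> borel_measurable borel" for n
    unfolding cos_prod_def by measurable
  have bound: "ennreal (norm (?F \<xi>)) \<le> indicator {- ?R..?R} \<xi> + (\<Sum>n. ?h n \<xi>)" for \<xi>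
  proof (cases "\<bar>\<xi>\<bar> \<le> ?R")
    case True
    have "ennreal (norm (?F \<xi>)) \<le> 1"
      using norm_fourier_transform_le_1[OF prob_space_random_bernoulli_convolution] by simp
    also have "\<dots> = indicator {- ?R..?R} \<xi>"
      using True by (simp add: abs_le_iff)
    finally show ?thesis
      by (rule order_trans) simp
  next
    case False
    define n where "n = (LEAST n. \<bar>\<xi>\<bar> \<le> T / c ^ Suc n)"
    have "\<exists>n. \<bar>\<xi>\<bar> \<le> T / c ^ Suc n"
    proof -
      obtain n where "\<bar>\<xi>\<bar> / T < (1 / c) ^ n"
        using c real_arch_pow[of "1 / c"] by auto
      also have "(1 / c) ^ n \<le> (1 / c) ^ Suc n"
        using c by (intro power_increasing) auto
      finally have "\<bar>\<xi>\<bar> < T * (1 / c) ^ Suc n"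
        using T by (simp only: pos_divide_less_eq mult.commute)
      then show ?thesis
        by (intro exI[of _ n]) (simp add: power_inverse divide_inverse)
    qed
    then have upper: "\<bar>\<xi>\<bar> \<le> T / c ^ Suc n"
      unfolding n_def by (rule LeastI_ex)
    have "N \<le> n"
    proof (rule ccontr)
      assume "\<not> N \<le> n"
      then have "c ^ N \<le> c ^ Suc n"
        using c by (intro power_decreasing) auto
      then have "T / c ^ Suc n \<le> ?R"
        using T c by (intro divide_left_mono mult_pos_pos zero_less_power) simp_all
      with upper False show False by linarith
    qed
    have lower: "T / c ^ n < \<bar>\<xi>\<bar>"
    proof (cases "n = N")
      case True
      with False show ?thesis by simp
    next
      case neq: False
      then obtain m where m: "n = Suc m"
        using \<open>N \<le> n\<close> by (cases n) auto
      then have "m < n" by simp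
      then have "\<not> \<bar>\<xi>\<bar> \<le> T / c ^ Suc m"
        using not_less_Least[of _ "\<lambda>n. \<bar>\<xi>\<bar> \<le> T / c ^ Suc n", folded n_def] by blast
      with m show ?thesis by simp
    qed
    have "T \<le> \<bar>\<xi>\<bar> * c ^ n"
      using lower c by (simp add: field_simps)
    also have "\<dots> \<le> \<bar>\<xi>\<bar> * ratio_prod \<omega> n"
      using N[OF \<open>N \<le> n\<close>] by (intro mult_left_mono) auto
    finally have h: "ennreal (cos_prod \<omega> \<xi> n) = ?h n \<xi>"
      using upper by (simp add: abs_le_iff)
    have term_le: "f n \<le> suminf f" for f :: "nat \<Rightarrow> ennreal"
      using sum_le_suminf[of f "{n}"] by simp
    have "ennreal (norm (?F \<xi>)) \<le> ennreal (cos_prod \<omega> \<xi> n)"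
      by (intro ennreal_leI norm_fourier_transform_le_cos_prod \<omega>)
    also have "\<dots> \<le> (\<Sum>n. ?h n \<xi>)"
      by (subst h) (rule term_le[of "\<lambda>n. ?h n \<xi>"])
    finally have "ennreal (norm (?F \<xi>)) \<le> (\<Sum>n. ?h n \<xi>)" .
    then show ?thesis
      by (rule order_trans) simp
  qed
  have "(\<integral>\<^sup>+\<xi>. ennreal (norm (?F \<xi>)) \<partial>lborel) \<le> (\<integral>\<^sup>+\<xi>. indicator {- ?R..?R} \<xi> + (\<Sum>n. ?h n \<xi>) \<partial>lborel)"
    by (intro nn_integral_mono bound)
  also have "\<dots> = emeasure lborel {- ?R..?R} + (\<integral>\<^sup>+\<xi>. (\<Sum>n. ?h n \<xi>) \<partial>lborel)"
    by (subst nn_integral_add) auto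
  also have "\<dots> < \<infinity>"
    using fin
    by (simp only: cos_majorant_def ennreal_add_less_top infinity_ennreal_def
        emeasure_lborel_Icc_eq top.not_eq_extremum) simp
  finally have "(\<integral>\<^sup>+\<xi>. ennreal (norm (?F \<xi>)) \<partial>lborel) < \<infinity>" .
  moreover have "?F \<in> borel_measurable lborel"
    using fourier_transform_measurable[OF prob_space_random_bernoulli_convolution]
    by (simp add: random_bernoulli_convolution_eq)
  ultimately show ?thesis
    by (rule integrableI_bounded[rotated])
qed

end

theorem theorem1:
  fixes a b :: real
  assumes "0 < a" and "a < b" and "b < 1"
    and "geometric_mean_ratio a b > 2 / pi"
  shows "AE \<omega> in ratio_measure a b.
           integrable lborel (fourier_transform (random_bernoulli_convolution \<omega>))"
proof -
  interpret random_ratios a b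
    by unfold_locales (use assms in auto)
  have "2 / pi < 1"
    using pi_gt3 by simp
  \<comment> \<open>\<open>c < 1\<close> lets the shells \<open>T / c ^ n \<le> \<bar>\<xi>\<bar> \<le> T / c ^ Suc n\<close> exhaust all large frequencies\<close>
  with assms(4) obtain c where c: "2 / pi < c" "c < geometric_mean_ratio a b" and "c < 1"
    using dense[of "2 / pi" "min (geometric_mean_ratio a b) 1"] by auto
  have "0 < 2 / pi" by simp
  with c have "0 < c" by linarith
  obtain q where q: "2 / pi < q" "q < c"
    using c(1) dense by blast
  then have "0 \<le> q" using \<open>0 < 2 / pi\<close> by linarith
  \<comment> \<open>chosen so that the mean bound \<open>2 / \<pi> + 4 / (\<pi> * T * (b - a))\<close> is exactly \<open>q\<close>\<close>
  define T where "T = 4 / (pi * (q - 2 / pi) * (b - a))"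
  have T: "0 < T" using q assms by (simp add: T_def)
  have mean: "(\<integral>\<^sup>+x. ennreal \<bar>cos (pi * (y * x))\<bar> \<partial>uniform_interval a b) \<le> ennreal q"
    if "T \<le> \<bar>y\<bar>" for y
  proof -
    have "y \<noteq> 0" using that T by auto
    have "4 / (pi * \<bar>y\<bar> * (b - a)) \<le> 4 / (pi * T * (b - a))"
      using that T assms by (intro divide_left_mono mult_right_mono mult_left_mono mult_pos_pos) auto
    also have "\<dots> = q - 2 / pi"
      using q(1) assms(2) unfolding T_def by (simp add: divide_simps)
    finally show ?thesis
      by (intro order_trans[OF nn_integral_abs_cos_uniform_interval_le[OF assms(2) \<open>y \<noteq> 0\<close>]]
          ennreal_leI) simp
  qed
  have integral_finite: "AE \<omega> in S. (\<integral>\<^sup>+\<xi>. cos_majorant T c \<omega> \<xi> \<partial>lborel) \<noteq> \<infinity>"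
    using T \<open>0 < c\<close> \<open>0 \<le> q\<close> q(2) mean by (rule AE_nn_integral_cos_majorant_finite)
  show ?thesis
    unfolding ratio_measure_eq
    using integral_finite AE_eventually_ratio_prod_ge[OF \<open>0 < c\<close> c(2)] AE_space
    by eventually_elim (rule integrable_fourier_transform[OF _ T \<open>0 < c\<close> \<open>c < 1\<close>])
qed

end
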